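(* Let $\gamma\in(1,2]$ and let $\mathcal F$ be the function associated with the $\gamma$-law equation of state and a conservative vector $\mathbf U=(D,\mathbf m^\top,\mathbf B^\top,E)^\top\in\mathcal G$ (see context). If the initial guess satisfies $\xi_0\in\Omega_3:=(\xi_b,\xi_*]$, then the Newton--Raphson iteration $\xi_{n+1}=\xi_n-\mathcal F(\xi_n)/\mathcal F'(\xi_n)$, $n=0,1,2,\dots$, is physical-constraint-preserving (PCP), that is, for all $n\ge 0$ $$\xi_n\in\Omega_1,\quad \rho(\xi_n)>0,\quad p(\xi_n)>0,\quad |\mathbf v(\xi_n)|<1,$$ and it is convergent, that is, $\lim_{n\to\infty}\xi_n=\xi_*$.
   Context: Conservative vectors are $\mathbf U=(D,\mathbf m^\top,\mathbf B^\top,E)^\top$ with $D,E\in\mathbb R$ and $\mathbf m,\mathbf B\in\mathbb R^3$. Write $m=|\mathbf m|$, $B=|\mathbf B|$, $\tau=\mathbf m\cdot\mathbf B$. The admissible set $\mathcal G$ is the set of all $\mathbf U$ with $D>0$, $E-\sqrt{D^2+m^2}>0$ and $\Psi(\mathbf U)>0$, where $$\Phi(\mathbf U)=\sqrt{(B^2-E)^2+3(E^2-D^2-m^2)},$$ $$\Psi(\mathbf U)=\big(\Phi(\mathbf U)-2(B^2-E)\big)\sqrt{\Phi(\mathbf U)+B^2-E}-\sqrt{\tfrac{27}{2}(D^2B^2+\tau^2)}.$$ The $\gamma$-law equation of state is $h=1+\frac{\gamma p}{(\gamma-1)\rho}$, equivalently $p=\mathcal P(\rho,h)=\frac{\gamma-1}{\gamma}\rho(h-1)$.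 Define $$f_a(\xi)=\xi^2(\xi+B^2)^2-\big(\xi^2m^2+(2\xi+B^2)\tau^2\big),\qquad f_b(\xi)=f_a(\xi)-D^2(\xi+B^2)^2.$$ For $\mathbf U\in\mathcal G$ it is known that $f_a$ has at least one non-negative root. Let $\xi_a$ be its largest non-negative root; then $\Omega_1:=\{\xi>0: f_a(\xi)>0\}=(\xi_a,+\infty)$. It is known that $f_b$ has a unique root $\xi_b$ in $\Omega_1$; put $\Omega_2:=(\xi_b,+\infty)$. For $\xi\in\Omega_1$ let $$\mathcal W(\xi)=\frac{\xi(\xi+B^2)}{\sqrt{f_a(\xi)}},$$ $$\mathcal F(\xi)=\xi-\frac{\gamma-1}{\gamma}\Big(\frac{\xi}{\mathcal W(\xi)^2}-\frac{D}{\mathcal W(\xi)}\Big)-\frac12\Big(\frac{B^2}{\mathcal W(\xi)^2}+\frac{\tau^2}{\xi^2}\Big)+B^2-E.$$ It is known that $\mathcal F$ has a unique root in $\Omega_2$, denoted $\xi_*$. For $\xi\in\Omega_1$ define $\mathbf v(\xi)=\frac{\mathbf m+\xi^{-1}\tau\mathbf B}{\xi+B^2}$, $\rho(\xi)=\frac{D}{\mathcal W(\xi)}$, $h(\xi)=\frac{\xi}{D\mathcal W(\xi)}$, $p(\xi)=\frac{\gamma-1}{\gamma}\rho(\xi)(h(\xi)-1)$. *)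

theory Defs
  imports "HOL-Analysis.Analysis"
begin

datatype conservative =
  Conservative (dens: real) (mom: "real ^ 3") (mag: "real ^ 3") (energy: real)

definition mag_sq :: "conservative \<Rightarrow> real" where
  "mag_sq U = (norm (mag U))\<^sup>2"

definition mom_sq :: "conservative \<Rightarrow> real" where
  "mom_sq U = (norm (mom U))\<^sup>2"

definition tau :: "conservative \<Rightarrow> real" where
  "tau U = mom U \<bullet> mag U"

definition Phi :: "conservative \<Rightarrow> real" where
  "Phi U = sqrt ((mag_sq U - energy U)\<^sup>2 + 3 * ((energy U)\<^sup>2 - (dens U)\<^sup>2 - mom_sq U))"

definition Psi :: "conservative \<Rightarrow> real" where
  "Psi U = (Phi U - 2 * (mag_sq U - energy U)) * sqrt (Phi U + mag_sq U - energy U)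
     - sqrt (27 / 2 * ((dens U)\<^sup>2 * mag_sq U + (tau U)\<^sup>2))"

text \<open>Every square root in \<^const>\<open>Phi\<close> and \<^const>\<open>Psi\<close> has a non-negative argument once the first two
  conditions below hold, so the values of \<^const>\<open>sqrt\<close> at negative reals play no role.\<close>

definition admissible :: "conservative set" where
  "admissible = {U. dens U > 0 \<and> energy U - sqrt ((dens U)\<^sup>2 + mom_sq U) > 0 \<and> Psi U > 0}"

definition gamma_law :: "real \<Rightarrow> real \<Rightarrow> real \<Rightarrow> real" where
  "gamma_law \<gamma> \<rho> h = (\<gamma> - 1) / \<gamma> * \<rho> * (h - 1)"

definition f_a :: "conservative \<Rightarrow> real \<Rightarrow> real" where
  "f_a U \<xi> = \<xi>\<^sup>2 * (\<xi> + mag_sq U)\<^sup>2 - (\<xi>\<^sup>2 * mom_sq U + (2 * \<xi> + mag_sq U) * (tau U)\<^sup>2)"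

definition f_b :: "conservative \<Rightarrow> real \<Rightarrow> real" where
  "f_b U \<xi> = f_a U \<xi> - (dens U)\<^sup>2 * (\<xi> + mag_sq U)\<^sup>2"

definition Omega1 :: "conservative \<Rightarrow> real set" where
  "Omega1 U = {\<xi>. \<xi> > 0 \<and> f_a U \<xi> > 0}"

definition xi_b :: "conservative \<Rightarrow> real" where
  "xi_b U = (THE \<xi>. \<xi> \<in> Omega1 U \<and> f_b U \<xi> = 0)"

definition Omega2 :: "conservative \<Rightarrow> real set" where
  "Omega2 U = {xi_b U <..}"

definition lorentz :: "conservative \<Rightarrow> real \<Rightarrow> real" where
  "lorentz U \<xi> = \<xi> * (\<xi> + mag_sq U) / sqrt (f_a U \<xi>)"

text \<open>The functions below are meant on \<^const>\<open>Omega1\<close>, which is open, so that the derivative of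
  \<open>F\<close> there does not depend on its values elsewhere.\<close>

definition F :: "real \<Rightarrow> conservative \<Rightarrow> real \<Rightarrow> real" where
  "F \<gamma> U \<xi> = \<xi>
     - (\<gamma> - 1) / \<gamma> * (\<xi> / (lorentz U \<xi>)\<^sup>2 - dens U / lorentz U \<xi>)
     - 1 / 2 * (mag_sq U / (lorentz U \<xi>)\<^sup>2 + (tau U)\<^sup>2 / \<xi>\<^sup>2)
     + mag_sq U - energy U"

definition xi_star :: "real \<Rightarrow> conservative \<Rightarrow> real" where
  "xi_star \<gamma> U = (THE \<xi>. \<xi> \<in> Omega2 U \<and> F \<gamma> U \<xi> = 0)"

definition Omega3 :: "real \<Rightarrow> conservative \<Rightarrow> real set" where
  "Omega3 \<gamma> U = {xi_b U <.. xi_star \<gamma> U}"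

definition velocity :: "conservative \<Rightarrow> real \<Rightarrow> real ^ 3" where
  "velocity U \<xi> = (1 / (\<xi> + mag_sq U)) *\<^sub>R (mom U + (tau U / \<xi>) *\<^sub>R mag U)"

definition rest_density :: "conservative \<Rightarrow> real \<Rightarrow> real" where
  "rest_density U \<xi> = dens U / lorentz U \<xi>"

definition enthalpy :: "conservative \<Rightarrow> real \<Rightarrow> real" where
  "enthalpy U \<xi> = \<xi> / (dens U * lorentz U \<xi>)"

definition pressure :: "real \<Rightarrow> conservative \<Rightarrow> real \<Rightarrow> real" where
  "pressure \<gamma> U \<xi> = gamma_law \<gamma> (rest_density U \<xi>) (enthalpy U \<xi>)"

text \<open>Division by zero and \<^const>\<open>deriv\<close> of a non-differentiable function are total in HOL; this
  predicate says that the Newton quotient at \<open>\<xi>\<close> is the genuine one.\<close>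

definition newton_defined :: "(real \<Rightarrow> real) \<Rightarrow> real \<Rightarrow> bool" where
  "newton_defined f \<xi> \<longleftrightarrow> f differentiable (at \<xi>) \<and> deriv f \<xi> \<noteq> 0"

definition physical :: "real \<Rightarrow> conservative \<Rightarrow> real \<Rightarrow> bool" where
  "physical \<gamma> U \<xi> \<longleftrightarrow> \<xi> \<in> Omega1 U \<and> rest_density U \<xi> > 0 \<and> pressure \<gamma> U \<xi> > 0
     \<and> norm (velocity U \<xi>) < 1"

end

(* Split m into its parts orthogonal and parallel to B, of squared lengths A and C, and put y = x + B^2.
   Then 1/W(x)^2 = s(x) = 1 - A/y^2 - C/x^2, and with u = A/y^3 + C/x^3, w = A/y^4 + C/x^4,
   g = (gamma-1)/gamma <= 1/2, one finds
     F'  = (1-g) s + (1-2g) x u + g D u / sqrt s > 0,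
     F'' = P - g D N,  P = 2 g u + 3 (1-2g) A B^2 / y^4,  N = 3 w / sqrt s + u^2 / sqrt s^3.
   The Cauchy-Schwarz inequality w^2 <= u (A/y^5 + C/x^5) shows that P/N is nondecreasing, so F changes
   at most once, from concave to convex. If this happens after the root xi_*, the Newton iterates from
   the left never overshoot; if before, they may overshoot once and then decrease to xi_*.
   That F has a root beyond xi_b needs F(xi_b) < 0, which is where Psi > 0 enters: Psi > 0 says that a
   cubic in x is positive at the larger root of the quadratic 3x^2 + 4(B^2-E)x + (B^2-E)^2 - (E^2-D^2-m^2). *)

theory Submission
  imports Defs
begin

lemma newton_step_le_of_concave:
  fixes f f' :: "real \<Rightarrow> real"
  assumes der: "\<And>y. x \<le> y \<Longrightarrow> y \<le> z \<Longrightarrow> (f has_real_derivative f' y) (at y)"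
    and dec: "\<And>y. x \<le> y \<Longrightarrow> y \<le> z \<Longrightarrow> f' y \<le> f' x"
    and "f' x > 0" "x \<le> z" "f z = 0"
  shows "x - f x / f' x \<le> z"
proof (cases "x = z")
  case False
  then have "x < z" using assms by simp
  then obtain c where c: "x < c" "c < z" "f z - f x = (z - x) * f' c"
    using MVT2[of x z f f'] der by blast
  then have "- f x \<le> (z - x) * f' x"
    using dec[of c] assms \<open>x < z\<close> by (simp add: mult_left_mono)
  then show ?thesis using assms(3) by (simp add: field_simps)
qed (use assms in simp)

lemma newton_step_ge_of_convex:
  fixes f f' :: "real \<Rightarrow> real"
  assumes der: "\<And>y. z \<le> y \<Longrightarrow> y \<le> x \<Longrightarrow> (f has_real_derivative f' y) (at y)"
    and inc: "\<And>y. z \<le> y \<Longrightarrow> y \<le> x \<Longrightarrow> f' y \<le> f' x"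
    and "f' x > 0" "z \<le> x" "f z = 0"
  shows "z \<le> x - f x / f' x"
proof (cases "x = z")
  case False
  then have "z < x" using assms by simp
  then obtain c where c: "z < c" "c < x" "f x - f z = (x - z) * f' c"
    using MVT2[of z x f f'] der by blast
  then have "f x \<le> (x - z) * f' x"
    using inc[of c] assms \<open>z < x\<close> by (simp add: mult_left_mono)
  then show ?thesis using assms(3) by (simp add: field_simps)
qed (use assms in simp)

lemma newton_limit_root:
  fixes f f' :: "real \<Rightarrow> real"
  assumes "isCont f L" "isCont f' L" "f' L \<noteq> 0"
    and rec: "\<And>n. X (Suc n) = X n - f (X n) / f' (X n)"
    and lim: "X \<longlonglongrightarrow> L"
  shows "f L = 0"
proof -
  have "(\<lambda>n. X n - f (X n) / f' (X n)) \<longlonglongrightarrow> L - f L / f' L"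
    by (intro tendsto_intros lim isCont_tendsto_compose[OF assms(1) lim]
        isCont_tendsto_compose[OF assms(2) lim] assms(3))
  moreover have "(\<lambda>n. X n - f (X n) / f' (X n)) \<longlonglongrightarrow> L"
    using LIMSEQ_Suc[OF lim] by (simp add: rec)
  ultimately have "L - f L / f' L = L" using LIMSEQ_unique by blast
  then show ?thesis using assms(3) by simp
qed

text \<open>Below the root the iterates increase. Either they never pass the root, or they do so once and
  the derivative is nondecreasing from the root on; then they decrease from that moment.\<close>

lemma newton_converges_from_left:
  fixes f f' :: "real \<Rightarrow> real"
  assumes der: "\<And>y. a < y \<Longrightarrow> (f has_real_derivative f' y) (at y)"
    and pos: "\<And>y. a < y \<Longrightarrow> f' y > 0"
    and cont: "\<And>y. a < y \<Longrightarrow> isCont f' y"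
    and shape: "(\<forall>x y. a < x \<and> x \<le> y \<and> y \<le> z \<longrightarrow> f' y \<le> f' x)
      \<or> (\<forall>x y. z \<le> x \<and> x \<le> y \<longrightarrow> f' x \<le> f' y)"
    and z: "a < z" "f z = 0"
    and X0: "a < X 0" "X 0 \<le> z"
    and rec: "\<And>n. X (Suc n) = X n - f (X n) / f' (X n)"
  shows "(\<forall>n. a < X n) \<and> X \<longlonglongrightarrow> z"
proof -
  have mono: "f x < f y" if "a < x" "x < y" for x y
  proof (rule DERIV_pos_imp_increasing[OF that(2)])
    fix t assume "x \<le> t" "t \<le> y"
    then have "a < t" using that by simp
    then show "\<exists>d. (f has_real_derivative d) (at t) \<and> 0 < d" using der pos by blast
  qed
  have root: "y = z" if "a < y" "f y = 0" for y
    using mono[of y z] mono[of z y] that z by (cases y z rule: linorder_cases) auto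
  have up: "X n \<le> X (Suc n)" if "a < X n" "X n \<le> z" for n
  proof -
    have "f (X n) \<le> 0" using mono[of "X n" z] that z by (cases "X n = z") auto
    then show ?thesis using pos[of "X n"] that by (simp add: rec divide_nonpos_pos)
  qed
  have down: "X (Suc n) \<le> X n" if "z \<le> X n" for n
  proof -
    have "f (X n) \<ge> 0" using mono[of z "X n"] that z by (cases "X n = z") auto
    then show ?thesis using pos[of "X n"] that z by (simp add: rec)
  qed
  have lim_root: "L = z" if "X \<longlonglongrightarrow> L" "a < L" for L
  proof (rule root[OF that(2) newton_limit_root[OF DERIV_isCont[OF der] cont _ rec that(1)]])
    show "f' L \<noteq> 0" using pos[OF that(2)] by simp
  qed (use that in simp_all)
  show ?thesis
  proof (cases "\<forall>n. X n \<le> z")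
    case True
    have aX: "a < X n" for n
    proof (induction n)
      case (Suc n)
      then show ?case using up[of n] True by force
    qed (use X0 in simp)
    have "incseq X" using up aX True by (intro incseq_SucI) auto
    then obtain L where L: "X \<longlonglongrightarrow> L" "\<forall>n. X n \<le> L"
      using incseq_convergent[of X z] True by auto
    then have "a < L" using aX[of 0] by (meson less_le_trans)
    then show ?thesis using lim_root L aX by auto
  next
    case False
    define k where "k = (LEAST n. z < X n)"
    have "\<exists>n. z < X n" using False by (simp add: not_le)
    then have k: "z < X k"
      unfolding k_def by (rule LeastI_ex)
    have below_k: "X n \<le> z" if "n < k" for n
      using not_less_Least[of n "\<lambda>n. z < X n"] that unfolding k_def not_less by blast
    have aX: "a < X n" if "n < k" for n
      using that
    proof (induction n)
      case (Suc n)
      then show ?case using up[of n] below_k[of n] by force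
    qed (use X0 in simp)
    obtain j where j: "k = Suc j" using k X0 by (cases k) auto
    have conv: "\<forall>x y. z \<le> x \<and> x \<le> y \<longrightarrow> f' x \<le> f' y"
    proof (rule ccontr)
      assume "\<not> ?thesis"
      then have dec: "f' y \<le> f' (X j)" if "X j \<le> y" "y \<le> z" for y
        using shape aX[of j] that j by blast
      have Xj: "a < X j" "X j \<le> z" using aX[of j] below_k[of j] j by auto
      have "X j - f (X j) / f' (X j) \<le> z"
      proof (rule newton_step_le_of_concave[OF der dec])
        show "0 < f' (X j)" using pos Xj by blast
      qed (use Xj z in auto)
      then show False using k by (simp add: j rec)
    qed
    have zX: "z \<le> X (n + k)" for n
    proof (induction n)
      case (Suc n)
      have inc: "f' y \<le> f' (X (n + k))" if "z \<le> y" "y \<le> X (n + k)" for y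
        using conv that by blast
      have "z \<le> X (n + k) - f (X (n + k)) / f' (X (n + k))"
      proof (rule newton_step_ge_of_convex[OF der inc])
        show "0 < f' (X (n + k))" using pos[of "X (n + k)"] Suc z(1) by simp
      qed (use Suc z in auto)
      then show ?case by (simp add: rec)
    qed (use k in simp)
    have "decseq (\<lambda>n. X (n + k))" using down[OF zX] by (intro decseq_SucI) simp
    then obtain L where L: "(\<lambda>n. X (n + k)) \<longlonglongrightarrow> L"
      using decseq_convergent[of "\<lambda>n. X (n + k)" z] zX by blast
    then have "z \<le> L" using zX by (intro LIMSEQ_le_const[OF L]) blast
    moreover have "X \<longlonglongrightarrow> L" using L by (rule LIMSEQ_offset)
    ultimately have "X \<longlonglongrightarrow> z" using lim_root[of L] z(1) by simp
    moreover have "a < X n" for n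
      using aX[of n] zX[of "n - k"] z(1) by (cases "n < k") auto
    ultimately show ?thesis by blast
  qed
qed

lemma DERIV_shifted_inverse_power:
  fixes c d x :: real
  assumes "0 < x + d"
  shows "((\<lambda>x. c / (x + d) ^ k) has_real_derivative - real k * (c / (x + d) ^ Suc k)) (at x)"
proof -
  have "((\<lambda>x. (x + d) ^ k) has_real_derivative real k * (x + d) ^ (k - 1)) (at x)"
    by (auto intro!: derivative_eq_intros)
  then have "((\<lambda>x. c * inverse ((x + d) ^ k)) has_real_derivative
      c * (- (real k * (x + d) ^ (k - 1) * inverse (((x + d) ^ k) ^ Suc (Suc 0))))) (at x)"
    using assms by (intro DERIV_cmult DERIV_inverse_fun) auto
  moreover have "real k * (x + d) ^ (k - 1) * inverse (((x + d) ^ k) ^ Suc (Suc 0))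
      = real k / (x + d) ^ Suc k"
  proof (cases k)
    case (Suc n)
    define y where "y = x + d"
    have "0 < y" using assms by (simp add: y_def)
    then show ?thesis unfolding Suc y_def[symmetric] by (simp add: field_simps)
  qed simp
  ultimately have "((\<lambda>x. c * inverse ((x + d) ^ k)) has_real_derivative
      c * (- (real k / (x + d) ^ Suc k))) (at x)"
    by (simp only:)
  then show ?thesis by (simp add: divide_inverse mult.left_commute)
qed

text \<open>The inequality \<open>P N' \<le> P' N\<close> at a point, with \<open>w\<^sup>2 \<le> u * z\<close> from Cauchy-Schwarz, \<open>q = 1 / s\<close>,
  \<open>p = 1 / y\<close>, \<open>k = 1 - 2 * g\<close> and \<open>e = A * B\<^sup>2 / y ^ 4\<close> in the notation of the header.\<close>

lemma quotient_derivative_sign: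
  fixes u w z q g k e p :: real
  assumes "0 \<le> u" "0 \<le> w" "0 \<le> z" "0 \<le> q" "0 \<le> g" "0 \<le> k" "0 \<le> e"
    and "w\<^sup>2 \<le> u * z" "p * w \<le> z" "p * u \<le> w"
  shows "(6 * g * w + 12 * k * e * p) * (3 * w + u\<^sup>2 * q)
    \<le> (2 * g * u + 3 * k * e) * (12 * z + 9 * u * w * q + 3 * u ^ 3 * q\<^sup>2)"
proof -
  have "6 * w * (3 * w + u\<^sup>2 * q) = 18 * w\<^sup>2 + 6 * u\<^sup>2 * w * q" by algebra
  also have "\<dots> \<le> 24 * (u * z) + 18 * u\<^sup>2 * w * q"
  proof (rule add_mono)
    have "0 \<le> u * z" using assms by simp
    then show "18 * w\<^sup>2 \<le> 24 * (u * z)" using assms(8) by linarith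
    show "6 * u\<^sup>2 * w * q \<le> 18 * u\<^sup>2 * w * q"
      using assms by (intro mult_right_mono) auto
  qed
  also have "\<dots> \<le> 24 * (u * z) + 18 * u\<^sup>2 * w * q + 6 * u ^ 4 * q\<^sup>2" by simp
  also have "\<dots> = 2 * u * (12 * z + 9 * u * w * q + 3 * u ^ 3 * q\<^sup>2)" by algebra
  finally have 1: "6 * w * (3 * w + u\<^sup>2 * q) \<le> 2 * u * (12 * z + 9 * u * w * q + 3 * u ^ 3 * q\<^sup>2)" .
  have "12 * p * (3 * w + u\<^sup>2 * q) = 36 * (p * w) + 12 * ((p * u) * (u * q))" by algebra
  also have "\<dots> \<le> 36 * z + 12 * (w * (u * q))"
    using assms by (intro add_mono mult_left_mono mult_right_mono) auto
  also have "\<dots> \<le> 36 * z + 27 * (w * (u * q)) + 9 * (u ^ 3 * q\<^sup>2)"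
    using assms by (simp add: add_increasing2)
  also have "\<dots> = 3 * (12 * z + 9 * u * w * q + 3 * u ^ 3 * q\<^sup>2)" by algebra
  finally have 2: "12 * p * (3 * w + u\<^sup>2 * q) \<le> 3 * (12 * z + 9 * u * w * q + 3 * u ^ 3 * q\<^sup>2)" .
  show ?thesis
    using add_mono[OF mult_left_mono[OF 1 assms(5)]
        mult_left_mono[OF 2 mult_nonneg_nonneg[OF assms(6,7)]]]
    by (simp add: algebra_simps)
qed

text \<open>\<open>A\<close> and \<open>C\<close> stand for the squared lengths of the parts of \<open>m\<close> orthogonal and parallel to
  \<open>B\<close>, and \<open>b\<close> for the squared length of \<open>B\<close>. In these terms
  the squared velocity at \<open>x\<close> is \<open>mm 2 x\<close>.\<close>

locale reduced =
  fixes A C b D :: real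
  assumes A: "0 \<le> A" and C: "0 \<le> C" and b: "0 \<le> b" and D: "0 < D"
begin

definition mm :: "nat \<Rightarrow> real \<Rightarrow> real" where
  "mm k x = A / (x + b) ^ k + C / x ^ k"

definition s :: "real \<Rightarrow> real" where
  "s x = 1 - mm 2 x"

definition P :: "real \<Rightarrow> real \<Rightarrow> real" where
  "P g x = 2 * g * mm 3 x + 3 * (1 - 2 * g) * (b * A / (x + b) ^ 4)"

definition N :: "real \<Rightarrow> real" where
  "N x = 3 * mm 4 x / sqrt (s x) + (mm 3 x)\<^sup>2 / sqrt (s x) ^ 3"

definition G :: "real \<Rightarrow> real \<Rightarrow> real \<Rightarrow> real" where
  "G g E x = x + b / 2 - E + b * A / (2 * (x + b)\<^sup>2) - g * (x * s x - D * sqrt (s x))"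

definition G' :: "real \<Rightarrow> real \<Rightarrow> real" where
  "G' g x = (1 - g) * s x + (1 - 2 * g) * (x * mm 3 x) + g * D * mm 3 x / sqrt (s x)"

lemma DERIV_mm:
  assumes "0 < x"
  shows "(mm k has_real_derivative - real k * mm (Suc k) x) (at x)"
  unfolding mm_def[abs_def]
  by (rule DERIV_cong[OF DERIV_add[OF DERIV_shifted_inverse_power[of x b A k]
        DERIV_shifted_inverse_power[of x 0 C k, simplified]]])
    (use assms b in \<open>auto simp: algebra_simps\<close>)

lemma mm_nonneg: "0 < x \<Longrightarrow> 0 \<le> mm k x"
  using A C b by (simp add: mm_def)

lemma mm_antimono:
  assumes "0 < x" "x \<le> y"
  shows "mm k y \<le> mm k x"
  unfolding mm_def using assms A C b
  by (intro add_mono divide_left_mono power_mono) auto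

lemma s_mono: "0 < x \<Longrightarrow> x \<le> y \<Longrightarrow> s x \<le> s y"
  using mm_antimono[of x y 2] by (simp add: s_def)

lemma mm_shift:
  assumes "0 < x"
  shows "mm k x = x * mm (Suc k) x + b * A / (x + b) ^ Suc k"
proof -
  define a c where "a = A / (x + b) ^ Suc k" and "c = C / x ^ Suc k"
  have "mm k x = (x + b) * a + x * c" using assms b by (simp add: mm_def a_def c_def)
  also have "\<dots> = x * (a + c) + b * a" by algebra
  finally show ?thesis by (simp add: mm_def a_def c_def)
qed

lemma mm_Cauchy:
  assumes "0 < x"
  shows "(mm 4 x)\<^sup>2 \<le> mm 3 x * mm 5 x"
proof -
  define p q where "p = inverse (x + b)" and "q = inverse x"
  have mm: "mm k x = A * p ^ k + C * q ^ k" for k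
    by (simp add: mm_def p_def q_def divide_inverse power_inverse)
  have "0 \<le> p" "0 \<le> q" using assms b by (auto simp: p_def q_def)
  have "mm 3 x * mm 5 x - (mm 4 x)\<^sup>2 = A * C * (p ^ 3 * q ^ 3) * (p - q)\<^sup>2"
    unfolding mm by algebra
  also have "\<dots> \<ge> 0" using A C \<open>0 \<le> p\<close> \<open>0 \<le> q\<close> by simp
  finally show ?thesis by simp
qed

lemma mm_Suc_ge:
  assumes "0 < x"
  shows "1 / (x + b) * mm k x \<le> mm (Suc k) x"
proof -
  have "C / x ^ k * (1 / (x + b)) \<le> C / x ^ k * (1 / x)"
    using assms b C by (intro mult_left_mono divide_left_mono) auto
  then show ?thesis by (simp add: mm_def distrib_left mult.commute)
qed

lemma DERIV_s:
  assumes "0 < x"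
  shows "(s has_real_derivative 2 * mm 3 x) (at x)"
  unfolding s_def[abs_def]
  using DERIV_mm[OF assms, of 2] by (auto intro!: derivative_eq_intros simp: eval_nat_numeral)

lemma DERIV_sqrt_s:
  assumes "0 < x" "0 < s x"
  shows "((\<lambda>x. sqrt (s x)) has_real_derivative mm 3 x / sqrt (s x)) (at x)"
  by (rule DERIV_cong[OF DERIV_chain2[OF DERIV_real_sqrt[OF assms(2)] DERIV_s[OF assms(1)]]])
    (simp add: field_simps)

lemma DERIV_G:
  assumes "0 < x" "0 < s x"
  shows "(G g E has_real_derivative G' g x) (at x)"
proof -
  have y: "((\<lambda>x. b * A / 2 / (x + b)\<^sup>2) has_real_derivative - (b * A / (x + b) ^ 3)) (at x)"
    by (rule DERIV_cong[OF DERIV_shifted_inverse_power[of x b "b * A / 2" 2]])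
      (use assms b in \<open>simp_all add: eval_nat_numeral\<close>)
  have "1 - s x = x * mm 3 x + b * A / (x + b) ^ 3"
    using mm_shift[OF assms(1), of 2] by (simp add: s_def eval_nat_numeral)
  then have eq: "1 = s x + x * mm 3 x + b * A / (x + b) ^ 3" by simp
  have "((\<lambda>x. x + b / 2 - E + b * A / 2 / (x + b)\<^sup>2 - g * (x * s x - D * sqrt (s x)))
    has_real_derivative 1 - b * A / (x + b) ^ 3
      - g * (s x + x * (2 * mm 3 x) - D * (mm 3 x / sqrt (s x)))) (at x)"
    by (rule derivative_eq_intros DERIV_s DERIV_sqrt_s y assms refl)+ simp
  also have "1 - b * A / (x + b) ^ 3 - g * (s x + x * (2 * mm 3 x) - D * (mm 3 x / sqrt (s x)))
      = G' g x"
    using eq by (simp add: G'_def algebra_simps)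
  finally show ?thesis by (simp add: G_def[abs_def])
qed

lemma DERIV_mm_over_sqrt_s:
  assumes "0 < x" "0 < s x"
  shows "((\<lambda>x. mm k x / sqrt (s x) ^ j) has_real_derivative
    - (real k * mm (Suc k) x / sqrt (s x) ^ j + real j * mm k x * mm 3 x / sqrt (s x) ^ (j + 2))) (at x)"
proof -
  have "((\<lambda>x. sqrt (s x) ^ j) has_real_derivative
      real j * sqrt (s x) ^ (j - 1) * (mm 3 x / sqrt (s x))) (at x)"
    using DERIV_power[OF DERIV_sqrt_s[OF assms], of j] by (simp add: mult_ac)
  moreover have "sqrt (s x) \<noteq> 0" using assms(2) by simp
  ultimately have "((\<lambda>x. mm k x / sqrt (s x) ^ j) has_real_derivative
    (- real k * mm (Suc k) x * sqrt (s x) ^ j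
      - mm k x * (real j * sqrt (s x) ^ (j - 1) * (mm 3 x / sqrt (s x))))
    / (sqrt (s x) ^ j * sqrt (s x) ^ j)) (at x)"
    by (intro DERIV_divide DERIV_mm assms) auto
  then show ?thesis
    by (rule DERIV_cong) (use \<open>sqrt (s x) \<noteq> 0\<close> in \<open>cases j; simp add: field_simps\<close>)
qed

lemma DERIV_G':
  assumes "0 < x" "0 < s x"
  shows "(G' g has_real_derivative P g x - g * D * N x) (at x)"
proof -
  have "((\<lambda>x. (1 - g) * s x + (1 - 2 * g) * (x * mm 3 x) + g * D * (mm 3 x / sqrt (s x) ^ 1))
    has_real_derivative (1 - g) * (2 * mm 3 x) + (1 - 2 * g) * (mm 3 x + x * (- 3 * mm 4 x))
      - g * D * N x) (at x)"
    using DERIV_add[OF DERIV_add[OF DERIV_cmult[OF DERIV_s[OF assms(1)]]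
        DERIV_cmult[OF DERIV_mult[OF DERIV_ident DERIV_mm[OF assms(1), of 3]]]]
        DERIV_cmult[OF DERIV_mm_over_sqrt_s[OF assms, of 3 1]]]
    by (rule DERIV_cong) (simp add: N_def power2_eq_square power3_eq_cube algebra_simps)
  also have "(1 - g) * (2 * mm 3 x) + (1 - 2 * g) * (mm 3 x + x * (- 3 * mm 4 x)) = P g x"
  proof -
    define e where "e = b * A / (x + b) ^ 4"
    have "mm 3 x = x * mm 4 x + e"
      using mm_shift[OF assms(1), of 3] by (simp add: e_def)
    then show ?thesis unfolding P_def e_def[symmetric] by (simp add: algebra_simps)
  qed
  finally show ?thesis by (simp add: G'_def[abs_def])
qed

lemma DERIV_P:
  assumes "0 < x"
  shows "(P g has_real_derivative
    - (6 * g * mm 4 x + 12 * (1 - 2 * g) * (b * A / (x + b) ^ 4) * (1 / (x + b)))) (at x)"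
proof -
  have "((\<lambda>x. b * A / (x + b) ^ 4) has_real_derivative
      - 4 * (b * A / (x + b) ^ 4 * (1 / (x + b)))) (at x)"
    by (rule DERIV_cong[OF DERIV_shifted_inverse_power[of x b "b * A" 4]])
      (use assms b in \<open>simp_all add: eval_nat_numeral\<close>)
  from DERIV_add[OF DERIV_cmult[OF DERIV_mm[OF assms, of 3], of "2 * g"]
      DERIV_cmult[OF this, of "3 * (1 - 2 * g)"]]
  show ?thesis unfolding P_def[abs_def]
    by (rule DERIV_cong) simp
qed

lemma DERIV_N:
  assumes "0 < x" "0 < s x"
  shows "(N has_real_derivative - ((12 * mm 5 x + 9 * mm 3 x * mm 4 x / s x
    + 3 * mm 3 x ^ 3 / (s x)\<^sup>2) / sqrt (s x))) (at x)"
proof -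
  define r where "r = sqrt (s x)"
  have r: "0 < r" "s x = r\<^sup>2" using assms(2) by (simp_all add: r_def)
  have "((\<lambda>x. 3 * (mm 4 x / sqrt (s x) ^ 1) + mm 3 x * (mm 3 x / sqrt (s x) ^ 3))
    has_real_derivative
      3 * - (4 * mm 5 x / sqrt (s x) + mm 4 x * mm 3 x / sqrt (s x) ^ 3)
      + (- 3 * mm 4 x * (mm 3 x / sqrt (s x) ^ 3)
        - mm 3 x * (3 * mm 4 x / sqrt (s x) ^ 3 + 3 * mm 3 x * mm 3 x / sqrt (s x) ^ 5))) (at x)"
    using DERIV_add[OF DERIV_cmult[OF DERIV_mm_over_sqrt_s[OF assms, of 4 1]]
        DERIV_mult[OF DERIV_mm[OF assms(1), of 3] DERIV_mm_over_sqrt_s[OF assms, of 3 3]]]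
    by (rule DERIV_cong) (simp add: power3_eq_cube algebra_simps)
  also have "3 * - (4 * mm 5 x / sqrt (s x) + mm 4 x * mm 3 x / sqrt (s x) ^ 3)
      + (- 3 * mm 4 x * (mm 3 x / sqrt (s x) ^ 3)
        - mm 3 x * (3 * mm 4 x / sqrt (s x) ^ 3 + 3 * mm 3 x * mm 3 x / sqrt (s x) ^ 5))
    = - ((12 * mm 5 x + 9 * mm 3 x * mm 4 x / s x + 3 * mm 3 x ^ 3 / (s x)\<^sup>2) / sqrt (s x))"
    unfolding r_def[symmetric] r(2) using r(1) by (simp add: field_simps eval_nat_numeral)
  finally show ?thesis by (simp add: N_def[abs_def] power2_eq_square)
qed

lemma N_pos:
  assumes "0 < x" "0 < s x" "A + C \<noteq> 0"
  shows "0 < N x"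
proof -
  have "0 < mm 4 x"
  proof (cases "A = 0")
    case True
    then show ?thesis unfolding mm_def using assms C by simp
  next
    case False
    then show ?thesis unfolding mm_def using assms A C b by (intro add_pos_nonneg) auto
  qed
  then show ?thesis using assms by (auto simp: N_def intro!: add_pos_nonneg)
qed

lemma P_over_N_mono:
  assumes g: "0 < g" "g \<le> 1 / 2" and x: "0 < x" "0 < s x" and "x \<le> y" and AC: "A + C \<noteq> 0"
  shows "P g x / N x \<le> P g y / N y"
proof (rule DERIV_nonneg_imp_nondecreasing[OF \<open>x \<le> y\<close>])
  fix t assume "x \<le> t" "t \<le> y"
  then have t: "0 < t" "0 < s t" using x s_mono[of x t] by auto
  have "0 < N t" using N_pos t AC by simp
  define q where "q = 1 / s t"
  have q: "0 \<le> q" "1 / (s t)\<^sup>2 = q\<^sup>2" using t by (auto simp: q_def power_divide)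
  have N: "N t = (3 * mm 4 t + (mm 3 t)\<^sup>2 * q) / sqrt (s t)"
    using t by (simp add: N_def q_def field_simps eval_nat_numeral)
  define dP where "dP = 6 * g * mm 4 t + 12 * (1 - 2 * g) * (b * A / (t + b) ^ 4) * (1 / (t + b))"
  define dN where "dN = (12 * mm 5 t + 9 * mm 3 t * mm 4 t * q + 3 * mm 3 t ^ 3 * q\<^sup>2) / sqrt (s t)"
  have N': "(N has_real_derivative - dN) (at t)"
    by (rule DERIV_cong[OF DERIV_N[OF t]]) (simp add: dN_def q_def power_divide)
  have P': "(P g has_real_derivative - dP) (at t)"
    unfolding dP_def using DERIV_P t by blast
  have "dP * (3 * mm 4 t + (mm 3 t)\<^sup>2 * q)
      \<le> P g t * (12 * mm 5 t + 9 * mm 3 t * mm 4 t * q + 3 * mm 3 t ^ 3 * q\<^sup>2)"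
    unfolding P_def dP_def
    by (rule quotient_derivative_sign)
      (use g t A b q mm_nonneg[OF t(1)] mm_Cauchy[OF t(1)] mm_Suc_ge[OF t(1), of 3]
        mm_Suc_ge[OF t(1), of 4] in auto)
  then have "dP * N t \<le> P g t * dN"
    unfolding N dN_def using t by (simp add: divide_right_mono)
  then have "0 \<le> (- dP * N t - P g t * - dN) / (N t * N t)"
    using \<open>0 < N t\<close> by simp
  moreover have "((\<lambda>x. P g x / N x) has_real_derivative
      (- dP * N t - P g t * - dN) / (N t * N t)) (at t)"
    using \<open>0 < N t\<close> by (intro DERIV_divide P' N' t) auto
  ultimately show "\<exists>d. ((\<lambda>x. P g x / N x) has_real_derivative d) (at t) \<and> 0 \<le> d" by blast
qed

lemma G''_nonneg_upward:
  assumes g: "0 < g" "g \<le> 1 / 2" and x: "0 < x" "0 < s x" and "x \<le> y"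
    and "0 \<le> P g x - g * D * N x"
  shows "0 \<le> P g y - g * D * N y"
proof (cases "A + C = 0")
  case True
  then have "A = 0" "C = 0" using A C by auto
  then have zero: "mm k t = 0" for k t unfolding mm_def by simp
  show ?thesis unfolding P_def N_def zero using \<open>A = 0\<close> by simp
next
  case False
  have y: "0 < y" "0 < s y" using x \<open>x \<le> y\<close> s_mono[of x y] by auto
  have "g * D \<le> P g x / N x"
    using assms N_pos[OF x False] by (simp add: field_simps)
  also have "\<dots> \<le> P g y / N y" using P_over_N_mono assms False by blast
  finally show ?thesis using N_pos[OF y False] by (simp add: field_simps)
qed

lemma G'_pos:
  assumes "0 < g" "g \<le> 1 / 2" "0 < x" "0 < s x"
  shows "0 < G' g x"
  unfolding G'_def using assms mm_nonneg[of x 3] D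
  by (intro add_pos_nonneg mult_pos_pos mult_nonneg_nonneg divide_nonneg_nonneg) auto

lemma ex_pressureless_root: "\<exists>x. 0 < x \<and> x\<^sup>2 * s x = D\<^sup>2"
proof -
  define R where "R = sqrt (D\<^sup>2 + A + C)"
  have "D \<le> R" using A C D by (auto simp: R_def intro!: real_le_rsqrt)
  have low: "D\<^sup>2 * s D \<le> D\<^sup>2" using mm_nonneg[of D 2] D by (simp add: s_def mult_left_le)
  have "A * (R\<^sup>2 / (R + b)\<^sup>2) \<le> A * 1"
    using A b D \<open>D \<le> R\<close> by (intro mult_left_mono) (auto intro!: power_mono divide_le_eq_1_pos[THEN iffD2])
  then have "D\<^sup>2 \<le> R\<^sup>2 * s R"
    using A C D \<open>D \<le> R\<close> by (simp add: s_def mm_def algebra_simps) (simp add: R_def)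
  moreover have "continuous_on {D..R} (\<lambda>x. x\<^sup>2 * s x)"
    using D by (intro continuous_at_imp_continuous_on ballI continuous_intros DERIV_isCont[OF DERIV_s]) auto
  ultimately obtain x where "D \<le> x" "x\<^sup>2 * s x = D\<^sup>2"
    using IVT'[of "\<lambda>x. x\<^sup>2 * s x" D "D\<^sup>2" R] low \<open>D \<le> R\<close> by auto
  then show ?thesis using D by (intro exI[of _ x]) auto
qed

lemma s_pos_of_pressureless_root:
  assumes "x\<^sup>2 * s x = D\<^sup>2"
  shows "0 < s x"
proof -
  have "0 < x\<^sup>2 * s x" using assms D by simp
  then show ?thesis by (simp add: zero_less_mult_iff)
qed

lemma above_pressureless_root:
  assumes "0 < x" "x\<^sup>2 * s x = D\<^sup>2" "x < y"
  shows "0 < s y" "D\<^sup>2 < y\<^sup>2 * s y"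
proof -
  have "0 < s x" using s_pos_of_pressureless_root assms by blast
  moreover have "s x \<le> s y" using s_mono assms by simp
  ultimately show "0 < s y" by simp
  have "x\<^sup>2 * s x < y\<^sup>2 * s x" using \<open>0 < s x\<close> assms
    by (intro mult_strict_right_mono power_strict_mono) auto
  also have "\<dots> \<le> y\<^sup>2 * s y" using \<open>s x \<le> s y\<close> by (simp add: mult_left_mono)
  finally show "D\<^sup>2 < y\<^sup>2 * s y" using assms by simp
qed

lemma D_less_of_square:
  assumes "0 < y" "0 < s y" "D\<^sup>2 < y\<^sup>2 * s y"
  shows "D < y * sqrt (s y)"
proof (rule power_less_imp_less_base)
  show "D\<^sup>2 < (y * sqrt (s y))\<^sup>2" using assms by (simp add: power_mult_distrib)
qed (use assms in simp)

lemma G_strict_mono: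
  assumes "0 < g" "g \<le> 1 / 2" "0 < x" "0 < s x" "x < y"
  shows "G g E x < G g E y"
proof (rule DERIV_pos_imp_increasing[OF \<open>x < y\<close>])
  fix t assume "x \<le> t" "t \<le> y"
  then have "0 < t" "0 < s t" using assms s_mono[of x t] by auto
  then show "\<exists>d. (G g E has_real_derivative d) (at t) \<and> 0 < d"
    using DERIV_G G'_pos assms by blast
qed

text \<open>With \<open>F\<^sub>0 = G 0 E\<close> (no pressure) and \<open>\<delta> = t\<^sup>2 * s t - D\<^sup>2\<close>, these two identities express the
  quadratic and the cubic hidden in \<^const>\<open>Phi\<close> and \<^const>\<open>Psi\<close> by \<open>F\<^sub>0\<close> and \<open>\<delta>\<close>.\<close>

lemma pressureless_identities:
  assumes "0 < t"
  shows "3 * t\<^sup>2 + 4 * (b - E) * t + (b - E)\<^sup>2 - (E\<^sup>2 - D\<^sup>2 - (A + C))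
      = 2 * (2 * t + b) * G 0 E t - (t\<^sup>2 * s t - D\<^sup>2)" (is ?quadratic)
    and "t\<^sup>2 * (t + (b - E)) - (D\<^sup>2 * b + C * b) / 2
      = t\<^sup>2 * G 0 E t + b / 2 * (t\<^sup>2 * s t - D\<^sup>2)" (is ?cubic)
proof -
  define p where "p = A / (t + b)\<^sup>2"
  have A': "A = p * (t + b)\<^sup>2" using assms b by (simp add: p_def)
  have s': "t\<^sup>2 * s t = t\<^sup>2 * (1 - p) - C"
    using assms by (simp add: s_def mm_def p_def algebra_simps)
  have G': "G 0 E t = t + b / 2 - E + b * p / 2" by (simp add: G_def p_def)
  show ?quadratic unfolding s' G' by (subst A') (simp add: power2_eq_square algebra_simps)
  show ?cubic unfolding s' G' by (simp add: power2_eq_square field_simps)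
qed

lemma G_neg_at_pressureless_root:
  fixes E :: real
  defines "\<beta> \<equiv> b - E" and "H \<equiv> E\<^sup>2 - D\<^sup>2 - (A + C)"
  defines "\<Phi> \<equiv> sqrt (\<beta>\<^sup>2 + 3 * H)"
  assumes x: "0 < x" "x\<^sup>2 * s x = D\<^sup>2"
    and H: "0 < H"
    and Psi: "sqrt (27 / 2 * (D\<^sup>2 * b + C * b)) < (\<Phi> - 2 * \<beta>) * sqrt (\<Phi> + \<beta>)"
  shows "G 0 E x < 0"
proof (rule ccontr)
  assume "\<not> G 0 E x < 0"
  then have Gx: "0 \<le> G 0 E x" by simp
  define K where "K = D\<^sup>2 * b + C * b"
  have "0 \<le> K" using C b by (simp add: K_def)
  have Phi2: "\<Phi>\<^sup>2 = \<beta>\<^sup>2 + 3 * H" using H by (simp add: \<Phi>_def)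
  have "sqrt (\<beta>\<^sup>2) < \<Phi>" unfolding \<Phi>_def using H by (intro real_sqrt_less_mono) simp
  then have Phi: "\<bar>\<beta>\<bar> < \<Phi>" by simp
  define t where "t = (\<Phi> - 2 * \<beta>) / 3"
  have "0 \<le> sqrt (27 / 2 * K)" using \<open>0 \<le> K\<close> by simp
  then have "0 < (\<Phi> - 2 * \<beta>) * sqrt (\<Phi> + \<beta>)" using Psi unfolding K_def by linarith
  moreover have "0 < sqrt (\<Phi> + \<beta>)" using Phi by simp
  ultimately have "0 < \<Phi> - 2 * \<beta>" by (simp add: zero_less_mult_iff)
  then have t: "0 < t" by (simp add: t_def)
  have quadratic: "3 * y\<^sup>2 + 4 * \<beta> * y + \<beta>\<^sup>2 - H = 3 * (y - t) * (y + (2 * \<beta> + \<Phi>) / 3)" for y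
    using Phi2 by (simp add: t_def field_simps power2_eq_square)
  have "(sqrt (27 / 2 * K))\<^sup>2 < ((\<Phi> - 2 * \<beta>) * sqrt (\<Phi> + \<beta>))\<^sup>2"
    using Psi \<open>0 \<le> K\<close> unfolding K_def[symmetric] by (intro power_strict_mono) auto
  then have "27 / 2 * K < (\<Phi> - 2 * \<beta>)\<^sup>2 * (\<Phi> + \<beta>)"
    using \<open>0 \<le> K\<close> Phi by (simp add: power_mult_distrib)
  also have "\<dots> = 27 * (t\<^sup>2 * (t + \<beta>))"
    by (simp add: t_def field_simps power2_eq_square)
  finally have cubic: "0 < t\<^sup>2 * (t + \<beta>) - K / 2" by linarith
  have delta: "t\<^sup>2 * s t - D\<^sup>2 = 2 * (2 * t + b) * G 0 E t"
    using pressureless_identities(1)[OF t, of E] quadratic[of t] by (simp add: \<beta>_def H_def)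
  have "0 < (t\<^sup>2 + b * (2 * t + b)) * G 0 E t"
    using pressureless_identities(2)[OF t, of E] cubic unfolding delta
    by (simp add: \<beta>_def K_def algebra_simps)
  moreover have "0 < t\<^sup>2 + b * (2 * t + b)" using t b by (intro add_pos_nonneg) auto
  ultimately have "0 < G 0 E t" by (rule zero_less_mult_pos)
  then have "0 < 2 * (2 * t + b) * G 0 E t" using t b by (intro mult_pos_pos) auto
  then have Dt: "D\<^sup>2 < t\<^sup>2 * s t" unfolding delta[symmetric] by simp
  have "x < t"
  proof (rule ccontr)
    assume "\<not> x < t"
    then have "t \<le> x" by simp
    then have "t\<^sup>2 * s t \<le> t\<^sup>2 * s x" using s_mono[OF t] by (simp add: mult_left_mono)
    also have "\<dots> \<le> x\<^sup>2 * s x"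
      using s_pos_of_pressureless_root[OF x(2)] t \<open>t \<le> x\<close> by (simp add: mult_right_mono power_mono)
    finally show False using Dt x(2) by simp
  qed
  have "0 \<le> 3 * (x - t) * (x + (2 * \<beta> + \<Phi>) / 3)"
  proof -
    have "3 * (x - t) * (x + (2 * \<beta> + \<Phi>) / 3) = 2 * (2 * x + b) * G 0 E x - (x\<^sup>2 * s x - D\<^sup>2)"
      using pressureless_identities(1)[OF x(1), of E] unfolding \<beta>_def[symmetric] H_def[symmetric] quadratic .
    then show ?thesis using Gx x b by simp
  qed
  moreover have "3 * (x - t) < 0" using \<open>x < t\<close> by simp
  ultimately have "x + (2 * \<beta> + \<Phi>) / 3 \<le> 0" by (metis mult_neg_pos not_le)
  then have "x + \<beta> < 0" using Phi by (simp add: field_simps)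
  then have "x\<^sup>2 * (x + \<beta>) < 0" using x(1) by (simp add: mult_pos_neg)
  moreover have "0 \<le> x\<^sup>2 * (x + \<beta>) - K / 2"
    unfolding \<beta>_def K_def pressureless_identities(2)[OF x(1)] x(2) using Gx by simp
  ultimately show False using \<open>0 \<le> K\<close> by simp
qed

lemma G_at_pressureless_root:
  assumes "0 < x" "x\<^sup>2 * s x = D\<^sup>2"
  shows "G g E x = G 0 E x"
proof -
  have "0 < s x" using s_pos_of_pressureless_root assms by blast
  have "sqrt (x\<^sup>2 * s x) = D" using assms D by simp
  then have "x * sqrt (s x) = D" using assms(1) by (simp only: real_sqrt_mult real_sqrt_abs abs_of_pos)
  then have "x * s x = D * sqrt (s x)"
    using \<open>0 < s x\<close> by (metis mult.assoc real_sqrt_mult_self abs_of_pos)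
  then show ?thesis by (simp add: G_def)
qed

lemma ex_root_G:
  assumes g: "0 < g" "g \<le> 1 / 2" and x: "0 < x" "x\<^sup>2 * s x = D\<^sup>2" and neg: "G g E x < 0"
  shows "\<exists>z>x. G g E z = 0"
proof -
  define R where "R = x + 2 * \<bar>E\<bar> + 1"
  have R: "x < R" "0 < R" "2 * E < R" using x by (auto simp: R_def)
  have sx: "0 < s x" using s_pos_of_pressureless_root x by blast
  have sR: "0 < s R" "s R \<le> 1"
    using above_pressureless_root(1)[OF x R(1)] mm_nonneg[OF R(2), of 2] by (auto simp: s_def)
  have "g * (R * s R - D * sqrt (s R)) \<le> 1 / 2 * R"
  proof (rule order_trans)
    have "R * s R \<le> R" using R sR by (simp add: mult_left_le)
    moreover have "0 \<le> D * sqrt (s R)" using D sR by simp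
    ultimately show "g * (R * s R - D * sqrt (s R)) \<le> g * R"
      using g by (intro mult_left_mono) auto
    show "g * R \<le> 1 / 2 * R" using g R by (intro mult_right_mono) auto
  qed
  moreover have "0 \<le> b * A / (2 * (R + b)\<^sup>2)" using A b by simp
  ultimately have "0 \<le> G g E R" using R b by (simp add: G_def)
  moreover have "continuous_on {x..R} (G g E)"
  proof (intro continuous_at_imp_continuous_on ballI)
    fix t assume "t \<in> {x..R}"
    then have "0 < t" "0 < s t" using x sx s_mono[of x t] by auto
    then show "isCont (G g E) t" using DERIV_G DERIV_isCont by blast
  qed
  ultimately obtain z where "x \<le> z" "G g E z = 0"
    using IVT'[of "G g E" x 0 R] neg R by auto
  then show ?thesis using neg by (intro exI[of _ z]) (auto simp: order_le_less)
qed

lemma newton_G: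
  assumes g: "0 < g" "g \<le> 1 / 2" and x: "0 < x" "x\<^sup>2 * s x = D\<^sup>2"
    and z: "x < z" "G g E z = 0"
    and X0: "x < X 0" "X 0 \<le> z"
    and rec: "\<And>n. X (Suc n) = X n - G g E (X n) / G' g (X n)"
  shows "(\<forall>n. x < X n) \<and> X \<longlonglongrightarrow> z"
proof (rule newton_converges_from_left[OF _ _ _ _ z X0 rec])
  define G'' where "G'' y = P g y - g * D * N y" for y
  have pos: "0 < y" "0 < s y" if "x < y" for y
    using that x above_pressureless_root[OF x that] by auto
  show "(G g E has_real_derivative G' g y) (at y)" "0 < G' g y" "isCont (G' g) y" if "x < y" for y
    using DERIV_G G'_pos g DERIV_isCont[OF DERIV_G'] pos[OF that] by blast+
  have der: "(G' g has_real_derivative G'' y) (at y)" if "x < y" for y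
    unfolding G''_def using DERIV_G' pos[OF that] by blast
  have up: "0 \<le> G'' v" if "x < u" "u \<le> v" "0 \<le> G'' u" for u v
    using G''_nonneg_upward[OF g pos[OF that(1)] that(2)] that(3) by (simp add: G''_def)
  show "(\<forall>u v. x < u \<and> u \<le> v \<and> v \<le> z \<longrightarrow> G' g v \<le> G' g u)
      \<or> (\<forall>u v. z \<le> u \<and> u \<le> v \<longrightarrow> G' g u \<le> G' g v)"
  proof (cases "0 \<le> G'' z")
    case True
    have "G' g u \<le> G' g v" if "z \<le> u" "u \<le> v" for u v
    proof (rule DERIV_nonneg_imp_nondecreasing[OF that(2)])
      fix t assume "u \<le> t" "t \<le> v"
      then have "x < t" "z \<le> t" using that z by auto
      then show "\<exists>d. (G' g has_real_derivative d) (at t) \<and> 0 \<le> d"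
        using der up[OF z(1) _ True] by blast
    qed
    then show ?thesis by blast
  next
    case False
    have "G' g v \<le> G' g u" if "x < u" "u \<le> v" "v \<le> z" for u v
    proof (rule DERIV_nonpos_imp_nonincreasing[OF that(2)])
      fix t assume "u \<le> t" "t \<le> v"
      then have "x < t" "t \<le> z" using that by auto
      then show "\<exists>d. (G' g has_real_derivative d) (at t) \<and> d \<le> 0"
        using der[of t] up[of t z] False by force
    qed
    then show ?thesis by blast
  qed
qed

end

lemma ex_orthogonal_parallel_split:
  "\<exists>A C. 0 \<le> A \<and> 0 \<le> C \<and> mom_sq U = A + C \<and> (tau U)\<^sup>2 = C * mag_sq U"
proof (cases "mag U = 0")
  case True
  then show ?thesis
    by (intro exI[of _ "mom_sq U"] exI[of _ 0]) (simp add: mom_sq_def tau_def)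
next
  case False
  then have pos: "0 < mag_sq U" by (simp add: mag_sq_def)
  have "(tau U)\<^sup>2 \<le> mom_sq U * mag_sq U"
    using Cauchy_Schwarz_ineq[of "mom U" "mag U"]
    by (simp add: tau_def mom_sq_def mag_sq_def power2_norm_eq_inner)
  then show ?thesis using pos
    by (intro exI[of _ "mom_sq U - (tau U)\<^sup>2 / mag_sq U"] exI[of _ "(tau U)\<^sup>2 / mag_sq U"])
      (simp add: field_simps)
qed

locale admissible_split = reduced A C "mag_sq U" "dens U" for A C U +
  assumes mom: "mom_sq U = A + C" and tau: "(tau U)\<^sup>2 = C * mag_sq U" and adm: "U \<in> admissible"
begin

lemma f_a_eq:
  assumes "0 < x"
  shows "f_a U x = (x * (x + mag_sq U))\<^sup>2 * s x"
proof -
  define p q where "p = A / (x + mag_sq U)\<^sup>2" and "q = C / x\<^sup>2"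
  have s': "s x = 1 - p - q" by (simp add: s_def mm_def p_def q_def)
  have A': "A = p * (x + mag_sq U)\<^sup>2" and C': "C = q * x\<^sup>2"
    using assms b by (simp_all add: p_def q_def)
  show ?thesis
    unfolding f_a_def mom tau s' by (subst A', (subst C')+) (simp add: algebra_simps power2_eq_square)
qed

lemma f_b_eq: "0 < x \<Longrightarrow> f_b U x = (x + mag_sq U)\<^sup>2 * (x\<^sup>2 * s x - (dens U)\<^sup>2)"
  by (simp add: f_b_def f_a_eq power_mult_distrib right_diff_distrib mult_ac)

lemma Omega1_iff: "x \<in> Omega1 U \<longleftrightarrow> 0 < x \<and> 0 < s x"
proof (cases "0 < x")
  case True
  then have "0 < (x * (x + mag_sq U))\<^sup>2" using b by simp
  then show ?thesis using True by (simp add: Omega1_def f_a_eq zero_less_mult_iff)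
qed (simp add: Omega1_def)

lemma lorentz_eq:
  assumes "0 < x"
  shows "lorentz U x = 1 / sqrt (s x)"
  using assms b by (simp add: lorentz_def f_a_eq real_sqrt_mult)

lemma F_eq:
  assumes "0 < x" "0 < s x"
  shows "F \<gamma> U x = G ((\<gamma> - 1) / \<gamma>) (energy U) x"
proof -
  define Q where "Q = mag_sq U * A / (x + mag_sq U)\<^sup>2"
  define p where "p = (\<gamma> - 1) / \<gamma> * (x * s x - dens U * sqrt (s x))"
  have "mag_sq U * s x + (tau U)\<^sup>2 / x\<^sup>2 = mag_sq U - Q"
    unfolding tau s_def mm_def Q_def by (simp add: algebra_simps)
  moreover have "F \<gamma> U x = x - p - 1 / 2 * (mag_sq U * s x + (tau U)\<^sup>2 / x\<^sup>2) + mag_sq U - energy U"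
    using assms by (simp add: F_def lorentz_eq power_divide p_def)
  moreover have "G ((\<gamma> - 1) / \<gamma>) (energy U) x = x + mag_sq U / 2 - energy U + Q / 2 - p"
    by (simp add: G_def Q_def p_def)
  ultimately show ?thesis by (simp add: field_simps)
qed

lemma xi_b: "0 < xi_b U" "(xi_b U)\<^sup>2 * s (xi_b U) = (dens U)\<^sup>2"
proof -
  have iff: "x \<in> Omega1 U \<and> f_b U x = 0 \<longleftrightarrow> 0 < x \<and> x\<^sup>2 * s x = (dens U)\<^sup>2" for x
    using b s_pos_of_pressureless_root[of x] by (auto simp: Omega1_iff f_b_eq)
  obtain x where x: "0 < x" "x\<^sup>2 * s x = (dens U)\<^sup>2" using ex_pressureless_root by blast
  have "y = x" if "0 < y" "y\<^sup>2 * s y = (dens U)\<^sup>2" for y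
    using above_pressureless_root(2)[OF x, of y] above_pressureless_root(2)[OF that, of x] x(2) that(2)
    by argo
  then have "xi_b U = x"
    unfolding xi_b_def iff using x by (intro the_equality) blast+
  then show "0 < xi_b U" "(xi_b U)\<^sup>2 * s (xi_b U) = (dens U)\<^sup>2" using x by simp_all
qed

lemma G_neg_at_xi_b: "G g (energy U) (xi_b U) < 0"
proof -
  have nonneg: "0 \<le> (dens U)\<^sup>2 + mom_sq U" by (simp add: mom_sq_def)
  have "sqrt ((dens U)\<^sup>2 + mom_sq U) < energy U" "0 < Psi U" using adm by (auto simp: admissible_def)
  moreover from this have "(sqrt ((dens U)\<^sup>2 + mom_sq U))\<^sup>2 < (energy U)\<^sup>2"
    using nonneg by (intro power_strict_mono) auto
  ultimately have "G 0 (energy U) (xi_b U) < 0"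
    using nonneg
    by (intro G_neg_at_pressureless_root xi_b)
      (auto simp: Psi_def Phi_def mom tau algebra_simps)
  then show ?thesis using G_at_pressureless_root[OF xi_b, of g "energy U"] by simp
qed

lemma xi_star:
  assumes "0 < (\<gamma> - 1) / \<gamma>" "(\<gamma> - 1) / \<gamma> \<le> 1 / 2"
  shows "xi_b U < xi_star \<gamma> U" "G ((\<gamma> - 1) / \<gamma>) (energy U) (xi_star \<gamma> U) = 0"
proof -
  let ?G = "G ((\<gamma> - 1) / \<gamma>) (energy U)"
  have pos: "0 < x" "0 < s x" if "xi_b U < x" for x
    using that xi_b above_pressureless_root[OF xi_b that] by auto
  have iff: "x \<in> Omega2 U \<and> F \<gamma> U x = 0 \<longleftrightarrow> xi_b U < x \<and> ?G x = 0" for x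
    using F_eq[OF pos] by (auto simp: Omega2_def)
  obtain z where z: "xi_b U < z" "?G z = 0"
    using ex_root_G[OF assms xi_b G_neg_at_xi_b] by blast
  have "y = z" if "xi_b U < y" "?G y = 0" for y
    using G_strict_mono[OF assms pos[OF that(1)], of z "energy U"]
      G_strict_mono[OF assms pos[OF z(1)], of y "energy U"] that(2) z(2)
    by argo
  then have "xi_star \<gamma> U = z"
    unfolding xi_star_def iff using z by (intro the_equality) blast+
  then show "xi_b U < xi_star \<gamma> U" "?G (xi_star \<gamma> U) = 0" using z by simp_all
qed

lemma DERIV_F:
  assumes "xi_b U < x"
  shows "(F \<gamma> U has_real_derivative G' ((\<gamma> - 1) / \<gamma>) x) (at x)"
proof (rule has_field_derivative_transform_within_open)
  have pos: "0 < x" "0 < s x" if "xi_b U < x" for x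
    using that xi_b above_pressureless_root[OF xi_b that] by auto
  show "(G ((\<gamma> - 1) / \<gamma>) (energy U) has_real_derivative G' ((\<gamma> - 1) / \<gamma>) x) (at x)"
    using DERIV_G pos assms by blast
  show "G ((\<gamma> - 1) / \<gamma>) (energy U) y = F \<gamma> U y" if "y \<in> {xi_b U<..}" for y
    using F_eq[OF pos] that by simp
qed (use assms in auto)

lemma norm_velocity:
  assumes "0 < x"
  shows "(norm (velocity U x))\<^sup>2 = 1 - s x"
proof -
  define p q where "p = A / (x + mag_sq U)\<^sup>2" and "q = C / x\<^sup>2"
  have s': "1 - s x = p + q" by (simp add: s_def mm_def p_def q_def)
  have y: "x + mag_sq U \<noteq> 0" using assms b by simp
  have A': "A = p * (x + mag_sq U)\<^sup>2" and C': "C = q * x\<^sup>2"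
    using assms y by (simp_all add: p_def q_def)
  have "mom U \<bullet> mom U = A + C" "mag U \<bullet> mag U = mag_sq U" "mom U \<bullet> mag U = tau U"
    "mag U \<bullet> mom U = tau U"
    using mom by (auto simp: mom_sq_def mag_sq_def tau_def power2_norm_eq_inner inner_commute)
  then have "(mom U + (tau U / x) *\<^sub>R mag U) \<bullet> (mom U + (tau U / x) *\<^sub>R mag U)
      = A + C + 2 * (tau U)\<^sup>2 / x + (tau U)\<^sup>2 * mag_sq U / x\<^sup>2"
    by (simp add: inner_add_left inner_add_right power2_eq_square distrib_left add_divide_distrib mult.assoc)
  then have "(norm (velocity U x))\<^sup>2
      = (A + C + 2 * (tau U)\<^sup>2 / x + (tau U)\<^sup>2 * mag_sq U / x\<^sup>2) / (x + mag_sq U)\<^sup>2"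
    by (simp add: velocity_def power_divide power2_norm_eq_inner[of "mom U + _"])
  also have "\<dots> = 1 - s x"
  proof -
    have "A + C + 2 * (C * mag_sq U) / x + C * mag_sq U * mag_sq U / x\<^sup>2
        = (p + q) * (x + mag_sq U)\<^sup>2"
      using assms by (subst A', (subst C')+) (simp add: algebra_simps power2_eq_square)
    then show ?thesis unfolding tau s' using y by simp
  qed
  finally show ?thesis .
qed

lemma physical_above_xi_b:
  assumes "1 < \<gamma>" "xi_b U < x"
  shows "physical \<gamma> U x"
proof -
  have x: "0 < x" "0 < s x" "(dens U)\<^sup>2 < x\<^sup>2 * s x"
    using assms xi_b above_pressureless_root[OF xi_b assms(2)] by auto
  have "dens U < x * sqrt (s x)" using D_less_of_square x by blast
  moreover have "enthalpy U x = x * sqrt (s x) / dens U"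
    using x by (simp add: enthalpy_def lorentz_eq)
  ultimately have "1 < enthalpy U x" using D by simp
  moreover have "0 < rest_density U x" using x D by (simp add: rest_density_def lorentz_eq)
  ultimately have "0 < pressure \<gamma> U x" using assms by (simp add: pressure_def gamma_law_def)
  moreover have "(norm (velocity U x))\<^sup>2 < 1\<^sup>2" using norm_velocity x by simp
  then have "norm (velocity U x) < 1" by (rule power_less_imp_less_base) simp
  ultimately show ?thesis
    using \<open>0 < rest_density U x\<close> x by (simp add: physical_def Omega1_iff)
qed

end

theorem theorem3p5:
  fixes \<gamma> :: real and U :: conservative and \<xi> :: "nat \<Rightarrow> real"
  assumes "1 < \<gamma>" and "\<gamma> \<le> 2"
    and "U \<in> admissible"
    and "\<xi> 0 \<in> Omega3 \<gamma> U"
    and "\<And>n. \<xi> (Suc n) = \<xi> n - F \<gamma> U (\<xi> n) / deriv (F \<gamma> U) (\<xi> n)"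
  shows "(\<forall>n. newton_defined (F \<gamma> U) (\<xi> n) \<and> physical \<gamma> U (\<xi> n))
    \<and> \<xi> \<longlonglongrightarrow> xi_star \<gamma> U"
proof -
  obtain A C where AC: "0 \<le> A" "0 \<le> C" "mom_sq U = A + C" "(tau U)\<^sup>2 = C * mag_sq U"
    using ex_orthogonal_parallel_split by blast
  interpret admissible_split A C U
    using AC assms(3) by unfold_locales (auto simp: admissible_def mag_sq_def)
  define g where "g = (\<gamma> - 1) / \<gamma>"
  have g: "0 < g" "g \<le> 1 / 2" using assms(1,2) by (auto simp: g_def field_simps)
  note star = xi_star[of \<gamma>, folded g_def, OF g]
  have pos: "0 < x" "0 < s x" if "xi_b U < x" for x
    using that xi_b above_pressureless_root[OF xi_b that] by auto
  have deriv: "deriv (F \<gamma> U) x = G' g x" if "xi_b U < x" for x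
    using DERIV_imp_deriv[OF DERIV_F[OF that]] by (simp add: g_def)
  define X where "X = rec_nat (\<xi> 0) (\<lambda>_ x. x - G g (energy U) x / G' g x)"
  have X: "(\<forall>n. xi_b U < X n) \<and> X \<longlonglongrightarrow> xi_star \<gamma> U"
    using assms(4) by (intro newton_G[OF g xi_b star]) (auto simp: X_def Omega3_def)
  have "\<xi> n = X n" for n
  proof (induction n)
    case (Suc n)
    have "xi_b U < X n" using X by blast
    then show ?case
      using Suc assms(5)[of n] deriv F_eq[OF pos] by (simp add: X_def g_def)
  qed (simp add: X_def)
  then have \<xi>: "\<xi> = X" by auto
  have "newton_defined (F \<gamma> U) (X n) \<and> physical \<gamma> U (X n)" for n
  proof -
    have n: "xi_b U < X n" using X by blast
    then have "F \<gamma> U differentiable (at (X n))"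
      using DERIV_F real_differentiable_def by blast
    then show ?thesis
      using deriv[OF n] G'_pos[OF g pos[OF n]] physical_above_xi_b[OF assms(1) n]
      by (simp add: newton_defined_def)
  qed
  then show ?thesis using X \<xi> by simp
qed

end
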